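(* Suppose $\nabla f$ is locally Lipschitz continuous on $\mathbb{N}$. Let $\{(\mathbf{w}^k,\mathbf{x}^k,\mathbf{y}^k;\mu_k)\}$ be the sequence generated by the ShaPeak algorithm with $\mathbf{Q}^k\succeq\mathbf{0}$, $\|\mathbf{Q}^k\|\leq\lambda$ for all $k$, and $\sigma\geq 8\max\{\lambda,\beta\}$. The following results hold. 1) $\{L(\mathbf{w}^k,\mathbf{x}^k,\mathbf{y}^k;\mu_k)\}$ and $\{\widetilde{L}^k\}$ converge to the same value, $\{\mu_k\}$ converges (to a limit denoted $\mu_\infty$), and $$\lim_{k\to\infty}\|\mathbf{w}^{k+1}-\mathbf{w}^k\|=\lim_{k\to\infty}\|\mathbf{x}^{k+1}-\mathbf{x}^k\|=\lim_{k\to\infty}\|\mathbf{y}^{k+1}-\mathbf{y}^k\|=\lim_{k\to\infty}\|\mathbf{w}^k-\mathbf{x}^k\|=0.$$ 2) Let $\mathbf{x}^\infty$ be any accumulation point of the sequence $\{\mathbf{x}^k\}$. Then, with $\tau=1/\sigma$, $\mathbf{x}^\infty$ is a P-stationary point of the problem $\min_{\mathbf{x}\in\mathbb{B}}F(\mathbf{x};\mu_\infty)$. 3) The sequence $\{\mathbf{x}^k\}$ converges to a binary P-stationary point $\mathbf{x}^\infty$ (of $\min_{\mathbf{x}\in\mathbb{B}}F(\mathbf{x};\mu_\infty)$) if $\mu_\infty>\overline{\mu}$.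
   Context: Setting. $f:\mathbb{R}^n\to\mathbb{R}\cup\{\infty\}$ is continuously differentiable; $B=[0,1]$, $\mathbb{B}=[0,1]^n$. $\|\cdot\|$ is the Euclidean norm of vectors and spectral norm of symmetric matrices. $\partial$ is the limiting subdifferential (Rockafellar–Wets, Definition 8.3), $N_B$ the normal cone of $B$, $\delta_B$ the indicator function of $B$. A function $g:\mathbb{R}\to\mathbb{R}\cup\{\infty\}$ is a sharp-peak function (SPF) if (c1) for any $x\in B$, $g(x)\geq 0$, and $g(x)=0$ iff $x\in\{0,1\}$; (c2) $g$ is lower semi-continuous on $B$ and there is $c>0$ with $|\nu|\geq c$ for all $\nu\in\partial g(x)$, $x\in B$; (c3) $\partial(g+\delta_B)(x)=\partial g(x)+N_B(x)$ for $x\in\{0,1\}$. Fix an SPF $g$ with constant $c$, and set $\varphi(\mathbf{x})=\sum_{i=1}^n g(x_i)$, $F(\mathbf{x};\mu)=f(\mathbf{x})+\mu\varphi(\mathbf{x})$, $\overline{\mu}=\max_{\mathbf{x}\in\mathbb{B}}\|\nabla f(\mathbf{x})\|_\infty/c$. P-stationary point of $\min_{\mathbf{x}\in\mathbb{B}}F(\mathbf{x};\mu)$ with parameter $\tau>0$: a point $\overline{\mathbf{x}}$ with $\overline{\mathbf{x}}\in\operatorname{argmin}_{\mathbf{z}\in\mathbb{B}}\frac12\|\mathbf{z}-(\overline{\mathbf{x}}-\tau\nabla f(\overline{\mathbf{x}}))\|^2+\tau\mu\varphi(\mathbf{z})$; $\overline{\mathbf{x}}$ is called P-stationary if this holds for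 some $\tau>0$. Binary means belonging to $\{0,1\}^n$. ShaPeak algorithm (stopping test ignored, so the sequence is infinite). Parameters: $\mu_0,\sigma>0$, $\eta>1$, $\rho\in(0,1/6]$, $\epsilon>0$, an integer $k_0>0$, symmetric matrices $\mathbf{Q}^k$. Initialize $\mathbf{w}^0=\mathbf{x}^0\in\{0,1\}^n$, $\mathbf{y}^0=-\nabla f(\mathbf{w}^0)$. For $k=0,1,2,\dots$: $$\mathbf{w}^{k+1}\in\operatorname{argmin}_{\mathbf{w}\in\mathbb{B}}\ \mu_k\varphi(\mathbf{w})+\langle\mathbf{y}^k,\mathbf{x}^k-\mathbf{w}\rangle+\tfrac{\sigma}{2}\|\mathbf{x}^k-\mathbf{w}\|^2,$$ $$\mathbf{x}^{k+1}=\mathbf{w}^{k+1}-(\sigma\mathbf{I}+\mathbf{Q}^{k+1})^{-1}(\nabla f(\mathbf{w}^{k+1})+\mathbf{y}^k),\qquad \mathbf{y}^{k+1}=\mathbf{y}^k+\sigma(\mathbf{x}^{k+1}-\mathbf{w}^{k+1}),$$ and, for each $k\geq1$, $\mu_k=\mu_{k-1}+\min\{(\eta-1)\mu_{k-1},\ \rho\sigma\|\mathbf{x}^k-\mathbf{w}^k\|^2/(\varphi(\mathbf{w}^k)+\epsilon)\}$ if $k_0$ divides $k$ and $\varphi(\mathbf{w}^k)\neq0$, and $\mu_k=\mu_{k-1}$ otherwise. Further notation. $L(\mathbf{w},\mathbf{x},\mathbf{y};\mu)=f(\mathbf{x})+\mu\varphi(\mathbf{w})+\langle\mathbf{y},\mathbf{x}-\mathbf{w}\rangle+\frac{\sigma}{2}\|\mathbf{x}-\mathbf{w}\|^2$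 and $\widetilde{L}^k=L(\mathbf{w}^k,\mathbf{x}^k,\mathbf{y}^k;\mu_k)+\frac{3\sigma}{8}\|\mathbf{x}^k-\mathbf{w}^k\|^2$. Let $f_B=\min_{\mathbf{w}\in\mathbb{B}}f(\mathbf{w})$, $\alpha=(2f(\mathbf{w}^0)-2f_B)/\sigma$, and $\mathbb{N}=\{\mathbf{x}\in\mathbb{R}^n:\|\mathbf{x}\|_\infty\leq 1+(\sqrt{n}+\sqrt{\alpha})/8\}$. $\lambda>0$ is a predefined constant, and $\beta\in(0,\infty)$ is a Lipschitz constant of $\nabla f$ on $\mathbb{N}$ (it exists since $\nabla f$ is locally Lipschitz on the compact set $\mathbb{N}$). A map is locally Lipschitz on a set if every point of the set has a neighbourhood on which it is Lipschitz. *)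

theory Defs
  imports "HOL-Analysis.Analysis"
begin

text \<open>Rockafellar--Wets, Definition 8.3.  The \<open>\<epsilon>\<close>-formula spells out \<open>h y \<ge> h x + v \<bullet> (y - x) + o(norm (y - x))\<close>.
  Both subdifferentials are empty where \<open>h\<close> is not finite.\<close>

definition regular_subdiff :: "('a::euclidean_space \<Rightarrow> ereal) \<Rightarrow> 'a \<Rightarrow> 'a set" where
  "regular_subdiff h x = {v. \<bar>h x\<bar> \<noteq> \<infinity> \<and>
     (\<forall>\<epsilon>>0. \<forall>\<^sub>F y in nhds x. h x + ereal (v \<bullet> (y - x) - \<epsilon> * norm (y - x)) \<le> h y)}"

definition limiting_subdiff :: "('a::euclidean_space \<Rightarrow> ereal) \<Rightarrow> 'a \<Rightarrow> 'a set" where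
  "limiting_subdiff h x = {v. \<bar>h x\<bar> \<noteq> \<infinity> \<and>
     (\<exists>X V. X \<longlonglongrightarrow> x \<and> (\<lambda>k. h (X k)) \<longlonglongrightarrow> h x \<and>
       (\<forall>k. V k \<in> regular_subdiff h (X k)) \<and> V \<longlonglongrightarrow> v)}"

definition indicator_fun :: "'a set \<Rightarrow> 'a \<Rightarrow> ereal" where
  "indicator_fun C x = (if x \<in> C then 0 else \<infinity>)"

text \<open>Normal cone in the sense of convex analysis; it is only used for the convex set \<open>[0,1]\<close>.\<close>

definition normal_cone :: "'a::euclidean_space set \<Rightarrow> 'a \<Rightarrow> 'a set" where
  "normal_cone C x = {v. x \<in> C \<and> (\<forall>z\<in>C. v \<bullet> (z - x) \<le> 0)}"

text \<open>Lower semicontinuity on \<open>[0,1]\<close> is taken relative to \<open>[0,1]\<close>, whereas the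
  subdifferential of \<open>g\<close> at the endpoints sees the values of \<open>g\<close> outside \<open>[0,1]\<close>.\<close>

definition sharp_peak_fun :: "(real \<Rightarrow> ereal) \<Rightarrow> real \<Rightarrow> bool" where
  "sharp_peak_fun g c \<longleftrightarrow>
     (\<forall>x. g x \<noteq> -\<infinity>) \<and>
     (\<forall>x\<in>{0..1}. 0 \<le> g x \<and> (g x = 0 \<longleftrightarrow> x \<in> {0, 1})) \<and>
     (\<forall>x\<in>{0..1}. g x \<le> Liminf (at x within {0..1}) g) \<and>
     0 < c \<and> (\<forall>x\<in>{0..1}. \<forall>\<nu>\<in>limiting_subdiff g x. c \<le> \<bar>\<nu>\<bar>) \<and>
     (\<forall>x\<in>{0, 1}. limiting_subdiff (\<lambda>t. g t + indicator_fun {0..1} t) x =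
        {u + v |u v. u \<in> limiting_subdiff g x \<and> v \<in> normal_cone {0..1} x})"

definition unit_cube :: "(real ^ 'n) set" where
  "unit_cube = {x. \<forall>i. x $ i \<in> {0..1}}"

definition binary_points :: "(real ^ 'n) set" where
  "binary_points = {x. \<forall>i. x $ i \<in> {0, 1}}"

definition penalty :: "(real \<Rightarrow> ereal) \<Rightarrow> real ^ 'n \<Rightarrow> ereal" where
  "penalty g x = (\<Sum>i\<in>UNIV. g (x $ i))"

text \<open>In the definitions below, \<open>G\<close> stands for the gradient of \<open>f\<close>.\<close>

definition mu_bar :: "(real ^ 'n \<Rightarrow> real ^ 'n) \<Rightarrow> real \<Rightarrow> real" where
  "mu_bar G c = (SUP x\<in>unit_cube. infnorm (G x)) / c"

definition P_stationary_with ::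
  "(real \<Rightarrow> ereal) \<Rightarrow> (real ^ 'n \<Rightarrow> real ^ 'n) \<Rightarrow> real \<Rightarrow> real \<Rightarrow> real ^ 'n \<Rightarrow> bool" where
  "P_stationary_with g G \<mu> \<tau> x \<longleftrightarrow> 0 < \<tau> \<and>
     is_arg_min (\<lambda>z. ereal (1/2 * (norm (z - (x - \<tau> *\<^sub>R G x)))\<^sup>2) + ereal (\<tau> * \<mu>) * penalty g z)
       (\<lambda>z. z \<in> unit_cube) x"

definition P_stationary ::
  "(real \<Rightarrow> ereal) \<Rightarrow> (real ^ 'n \<Rightarrow> real ^ 'n) \<Rightarrow> real \<Rightarrow> real ^ 'n \<Rightarrow> bool" where
  "P_stationary g G \<mu> x \<longleftrightarrow> (\<exists>\<tau>. P_stationary_with g G \<mu> \<tau> x)"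

text \<open>The update of \<open>\<mu>\<close> is stated in \<open>ereal\<close>, so that no value of the penalty has to be
  truncated.\<close>

definition ShaPeak_sequence ::
  "(real \<Rightarrow> ereal) \<Rightarrow> (real ^ 'n \<Rightarrow> real ^ 'n) \<Rightarrow> real \<Rightarrow> real \<Rightarrow> real \<Rightarrow> real \<Rightarrow> real \<Rightarrow> nat \<Rightarrow>
   (nat \<Rightarrow> real ^ 'n ^ 'n) \<Rightarrow> (nat \<Rightarrow> real ^ 'n) \<Rightarrow> (nat \<Rightarrow> real ^ 'n) \<Rightarrow> (nat \<Rightarrow> real ^ 'n) \<Rightarrow>
   (nat \<Rightarrow> real) \<Rightarrow> bool" where
  "ShaPeak_sequence g G \<mu>\<^sub>0 \<sigma> \<eta> \<rho> \<epsilon> k\<^sub>0 Q w x y \<mu> \<longleftrightarrow>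
     w 0 = x 0 \<and> x 0 \<in> binary_points \<and> y 0 = - G (w 0) \<and> \<mu> 0 = \<mu>\<^sub>0 \<and>
     (\<forall>k. is_arg_min
        (\<lambda>u. ereal (\<mu> k) * penalty g u + ereal (y k \<bullet> (x k - u) + \<sigma> / 2 * (norm (x k - u))\<^sup>2))
        (\<lambda>u. u \<in> unit_cube) (w (Suc k))) \<and>
     (\<forall>k. x (Suc k) = w (Suc k) - matrix_inv (mat \<sigma> + Q (Suc k)) *v (G (w (Suc k)) + y k)) \<and>
     (\<forall>k. y (Suc k) = y k + \<sigma> *\<^sub>R (x (Suc k) - w (Suc k))) \<and>
     (\<forall>k\<ge>1. ereal (\<mu> k) =
        (if k\<^sub>0 dvd k \<and> penalty g (w k) \<noteq> 0
         then ereal (\<mu> (k - 1)) +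
           min (ereal ((\<eta> - 1) * \<mu> (k - 1)))
               (ereal (\<rho> * \<sigma> * (norm (x k - w k))\<^sup>2) / (penalty g (w k) + ereal \<epsilon>))
         else ereal (\<mu> (k - 1))))"

definition aug_Lagrangian ::
  "(real ^ 'n \<Rightarrow> real) \<Rightarrow> (real \<Rightarrow> ereal) \<Rightarrow> real \<Rightarrow>
   real ^ 'n \<Rightarrow> real ^ 'n \<Rightarrow> real ^ 'n \<Rightarrow> real \<Rightarrow> ereal" where
  "aug_Lagrangian f g \<sigma> w x y \<mu> =
     ereal (f x) + ereal \<mu> * penalty g w + ereal (y \<bullet> (x - w) + \<sigma> / 2 * (norm (x - w))\<^sup>2)"

definition alpha_const :: "(real ^ 'n \<Rightarrow> real) \<Rightarrow> real \<Rightarrow> real ^ 'n \<Rightarrow> real" where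
  "alpha_const f \<sigma> w\<^sub>0 = (2 * f w\<^sub>0 - 2 * (INF w\<in>unit_cube. f w)) / \<sigma>"

definition region_N :: "(real ^ 'n \<Rightarrow> real) \<Rightarrow> real \<Rightarrow> real ^ 'n \<Rightarrow> (real ^ 'n) set" where
  "region_N f \<sigma> w\<^sub>0 =
     {x. infnorm x \<le> 1 + (sqrt (real CARD('n)) + sqrt (alpha_const f \<sigma> w\<^sub>0)) / 8}"

definition locally_lipschitz_at_points_of ::
  "'a::metric_space set \<Rightarrow> ('a \<Rightarrow> 'b::metric_space) \<Rightarrow> bool" where
  "locally_lipschitz_at_points_of S F \<longleftrightarrow> (\<forall>x\<in>S. \<exists>U L. open U \<and> x \<in> U \<and> L-lipschitz_on U F)"

definition accumulation_point :: "(nat \<Rightarrow> 'a::topological_space) \<Rightarrow> 'a \<Rightarrow> bool" where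
  "accumulation_point X l \<longleftrightarrow> (\<exists>r. strict_mono r \<and> (X \<circ> r) \<longlonglongrightarrow> l)"

end

theory Submission
  imports Defs
begin

text \<open>
  The proof follows a potential, the augmented Lagrangian plus \<open>3\<sigma>/8 (norm (x - w))\<^sup>2\<close>, that decreases along
  the run.  Write \<open>gap k\<close> for \<open>norm (x k - w k)\<close> and \<open>move k\<close> for \<open>norm (x (k + 1) - x k)\<close>.

  The choice of \<open>x\<close> and \<open>y\<close> makes \<open>y k = - G (w k) - Q k (x k - w k)\<close> an invariant (\<open>y_eq\<close>).  It bounds the
  next gap by an eighth of the sum of the last move of \<open>w\<close> and the last gap (\<open>gap_step\<close>), because the
  Lipschitz constant and the norm of \<open>Q\<close> are at most \<open>\<sigma>/8\<close>.  In one iteration the \<open>w\<close>-step does no harm; the \<open>x\<close>-step almost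
  minimises a strongly convex function and gains a multiple of \<open>(move k)\<^sup>2\<close> (\<open>x_step\<close>); the dual step and the
  increase of \<open>\<mu>\<close> cost multiples of the squared next gap, which the bound on gaps converts into less than was
  gained or stored in the potential.  Hence the potential drops by at least
  \<open>\<sigma>/20 ((move k)\<^sup>2 + (gap k)\<^sup>2)\<close> (\<open>merit_descent\<close>).  The Lipschitz bound is given only on a neighbourhood
  of the cube, and that \<open>x\<close> never leaves it is part of the same induction (\<open>x_in_region_and_merit_le\<close>).

  The potential is bounded below by the minimum of \<open>f\<close> on the cube (\<open>merit_lower\<close>), so \<open>move\<^sup>2\<close> and \<open>gap\<^sup>2\<close> are
  summable.  This gives all limits in the first part; the increments of \<open>\<mu>\<close> are dominated by squared gaps, so
  \<open>\<mu>\<close> converges as well.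

  For the second part, the minimising property of \<open>w (k + 1)\<close> passes to the limit by lower semicontinuity of the
  penalty (\<open>accumulation_point_P_stationary\<close>).

  For the third part, a coordinate of \<open>w (k + 1)\<close> strictly between 0 and 1 would be a minimiser of a
  one-dimensional problem and so yield a limiting subgradient of \<open>g\<close>, of size at most about
  \<open>infnorm (G w) / \<mu>\<close>.  Once
  \<open>\<mu>\<close> is close to a limit above \<open>mu_bar G c\<close>, this is below \<open>c\<close>, which the sharp-peak property excludes
  (\<open>eventually_w_binary\<close>).  Binary iterates with vanishing steps are eventually constant.
\<close>

section \<open>Gradients, matrices, the unit cube and an arithmetic estimate\<close>

text \<open>The quadratic minorant that a Lipschitz gradient gives.  Along the segment from \<open>a\<close> to \<open>b\<close>, the
  difference of the two sides has derivative
  \<open>(G (a + t h) - G a) \<bullet> h + \<beta> t (norm h)\<^sup>2\<close>, which Cauchy--Schwarz makes nonnegative.  Only points of the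
  segment enter, so a Lipschitz bound on a convex set suffices.\<close>
lemma lipschitz_gradient_lower_bound:
  fixes f :: "'a::euclidean_space \<Rightarrow> real"
  assumes grad: "\<And>z. GDERIV f z :> G z" and lip: "\<beta>-lipschitz_on S G"
    and "convex S" "a \<in> S" "b \<in> S"
  shows "f a + G a \<bullet> (b - a) - \<beta> / 2 * (norm (b - a))\<^sup>2 \<le> f b"
proof -
  define h where "h = b - a"
  define \<psi> where "\<psi> t = f (a + t *\<^sub>R h) - t * (G a \<bullet> h) + \<beta> / 2 * t\<^sup>2 * (norm h)\<^sup>2" for t
  have "\<psi> 0 \<le> \<psi> 1"
  proof (rule DERIV_nonneg_imp_nondecreasing[where f = \<psi> and a = 0 and b = 1])
    fix t :: real assume t: "0 \<le> t" "t \<le> 1"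
    have "((\<lambda>t. f (a + t *\<^sub>R h)) has_derivative (\<lambda>s. (s *\<^sub>R h) \<bullet> G (a + t *\<^sub>R h))) (at t)"
      by (rule has_derivative_compose[OF _ grad[unfolded gderiv_def], of "\<lambda>t. a + t *\<^sub>R h"])
         (auto intro!: derivative_eq_intros)
    then have "((\<lambda>t. f (a + t *\<^sub>R h)) has_real_derivative (G (a + t *\<^sub>R h) \<bullet> h)) (at t)"
      unfolding has_field_derivative_def
      by (rule has_derivative_eq_rhs) (auto simp: inner_commute mult.commute)
    then have D: "(\<psi> has_real_derivative
        (G (a + t *\<^sub>R h) - G a) \<bullet> h + \<beta> * t * (norm h)\<^sup>2) (at t)"
      unfolding \<psi>_def by (auto intro!: derivative_eq_intros simp: inner_diff_left)
    have "a + t *\<^sub>R h = (1 - t) *\<^sub>R a + t *\<^sub>R b" by (simp add: h_def algebra_simps)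
    with assms t have "a + t *\<^sub>R h \<in> S" by (auto simp: convex_alt)
    from lipschitz_onD[OF lip this \<open>a \<in> S\<close>] t
    have "norm (G (a + t *\<^sub>R h) - G a) \<le> \<beta> * (t * norm h)" by (simp add: dist_norm)
    then have "norm (G (a + t *\<^sub>R h) - G a) * norm h \<le> \<beta> * (t * norm h) * norm h"
      by (rule mult_right_mono) simp
    moreover have "\<bar>(G (a + t *\<^sub>R h) - G a) \<bullet> h\<bar> \<le> norm (G (a + t *\<^sub>R h) - G a) * norm h"
      by (rule Cauchy_Schwarz_ineq2)
    ultimately have "0 \<le> (G (a + t *\<^sub>R h) - G a) \<bullet> h + \<beta> * t * (norm h)\<^sup>2"
      by (simp add: power2_eq_square mult.assoc)
    with D show "\<exists>y. DERIV \<psi> t :> y \<and> 0 \<le> y" by blast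
  qed simp
  then show ?thesis by (simp add: \<psi>_def h_def)
qed

lemma convex_infnorm_ball: "convex {x::'a::euclidean_space. infnorm x \<le> r}"
proof (rule convexI, simp)
  fix x y :: 'a and u v :: real
  assume a: "infnorm x \<le> r" "infnorm y \<le> r" "0 \<le> u" "0 \<le> v" "u + v = 1"
  have "infnorm (u *\<^sub>R x + v *\<^sub>R y) \<le> u * infnorm x + v * infnorm y"
    using infnorm_triangle[of "u *\<^sub>R x" "v *\<^sub>R y"] a by (simp add: infnorm_mul)
  also have "\<dots> \<le> u * r + v * r" using a by (intro add_mono mult_left_mono)
  also have "\<dots> = r" using a by (simp flip: distrib_right)
  finally show "infnorm (u *\<^sub>R x + v *\<^sub>R y) \<le> r" .
qed

lemma mat_mult_vec: "mat s *v v = s *\<^sub>R (v :: real ^ 'n)"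
  by (simp add: vec_eq_iff matrix_vector_mult_def mat_def if_distrib[of "\<lambda>c. c * _"] cong: if_cong)

lemma shifted_psd_matrix_inv:
  fixes Q :: "real ^ 'n ^ 'n"
  assumes "0 < s" and psd: "\<And>v. 0 \<le> v \<bullet> (Q *v v)"
  shows "(mat s + Q) *v (matrix_inv (mat s + Q) *v v) = v"
proof -
  have "v = 0" if "(mat s + Q) *v v = 0" for v
  proof -
    have "v \<bullet> ((mat s + Q) *v v) = s * (v \<bullet> v) + v \<bullet> (Q *v v)"
      by (simp add: matrix_vector_mult_add_rdistrib mat_mult_vec inner_add_right)
    with that have "s * (v \<bullet> v) \<le> 0" using psd[of v] by simp
    with \<open>0 < s\<close> have "v \<bullet> v \<le> 0" by (simp add: mult_le_0_iff)
    then show "v = 0" by (metis inner_ge_zero inner_eq_zero_iff order_antisym)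
  qed
  then have "invertible (mat s + Q)"
    by (metis invertible_left_inverse matrix_left_invertible_ker)
  then have "(mat s + Q) ** matrix_inv (mat s + Q) = mat 1"
    unfolding invertible_def matrix_inv_def by (rule someI_ex[THEN conjunct1])
  then show ?thesis by (simp add: matrix_vector_mul_assoc)
qed

text \<open>Testing \<open>s v + Q v\<close> against \<open>v\<close> loses nothing but the nonnegative term \<open>v \<bullet> Q v\<close>.  In the algorithm
  this turns the defining equation of \<open>x (k + 1) - w (k + 1)\<close> into a bound on its norm.\<close>
lemma shifted_psd_norm_le:
  fixes Q :: "real ^ 'n ^ 'n"
  assumes "0 \<le> v \<bullet> (Q *v v)"
  shows "s * norm v \<le> norm (s *\<^sub>R v + Q *v v)"
proof (cases "v = 0")
  case False
  have "s * norm v * norm v \<le> v \<bullet> (s *\<^sub>R v + Q *v v)"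
    using assms by (simp add: inner_add_right dot_square_norm power2_eq_square)
  also have "\<dots> \<le> norm v * norm (s *\<^sub>R v + Q *v v)" by (rule norm_cauchy_schwarz)
  finally show ?thesis using False by (simp add: mult.commute)
qed simp

lemma cube_diff_norm_le:
  fixes u v :: "real ^ 'n"
  assumes "u \<in> unit_cube" "v \<in> unit_cube"
  shows "norm (u - v) \<le> sqrt (real CARD('n))"
proof -
  have "\<bar>(u - v) $ i\<bar> \<le> \<bar>(1 :: real ^ 'n) $ i\<bar>" for i
    using assms by (auto simp: unit_cube_def abs_le_iff)
       (smt (verit, best))+
  then have "norm (u - v) \<le> norm (1 :: real ^ 'n)"
    by (intro norm_le_componentwise_cart) simp
  also have "\<dots> = sqrt (real CARD('n))" by (simp add: norm_vec_def L2_set_def)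
  finally show ?thesis .
qed

lemma infnorm_cube_le: "u \<in> unit_cube \<Longrightarrow> infnorm (u :: real ^ 'n) \<le> 1"
  unfolding infnorm_cart by (rule cSup_least) (auto simp: unit_cube_def)

lemma compact_unit_cube: "compact (unit_cube :: (real ^ 'n) set)"
proof -
  have "unit_cube = cbox 0 (1 :: real ^ 'n)"
    by (auto simp: unit_cube_def mem_box_cart)
  then show ?thesis by (metis compact_cbox)
qed

lemma binary_points_subset_cube: "binary_points \<subseteq> unit_cube"
proof
  fix x :: "real ^ 'n" assume x: "x \<in> binary_points"
  have "x $ i \<in> {0..1}" for i using x[unfolded binary_points_def, simplified, rule_format, of i] by auto
  then show "x \<in> unit_cube" by (simp add: unit_cube_def)
qed

lemma binary_points_separated:
  assumes "u \<in> binary_points" "v \<in> binary_points" "norm (u - v) < 1"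
  shows "u = v"
proof (rule ccontr)
  assume "u \<noteq> v"
  then obtain i where i: "u $ i \<noteq> v $ i" by (auto simp: vec_eq_iff)
  have "u $ i \<in> {0,1}" "v $ i \<in> {0,1}" using assms by (auto simp: binary_points_def)
  with i have "\<bar>(u - v) $ i\<bar> = 1" by auto
  then show False using component_le_norm_cart[of "u - v" i] assms by simp
qed

text \<open>The arithmetic behind the descent of the potential, with \<open>P\<close>, \<open>D\<close>, \<open>D'\<close> standing for
  \<open>norm (x (k + 1) - x k)\<close>, \<open>norm (x k - w k)\<close> and \<open>norm (x (k + 1) - w (k + 1))\<close>.
  The coefficient \<open>37/24 = 1 + 1/6 + 3/8\<close> collects, in units of \<open>\<sigma>\<close>, the dual step, the penalty update
  and the extra term of the potential; \<open>1/4\<close> and \<open>7/16\<close> come from the step in \<open>x\<close>.  The hypothesis bounds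
  \<open>D'\<close> by \<open>(P + 2 D) / 7\<close>, which makes the positive terms small enough to be absorbed.\<close>
lemma descent_arith:
  fixes P D D' :: real
  assumes "0 \<le> P" "0 \<le> D" "0 \<le> D'" "7 * D' \<le> P + 2 * D"
  shows "37/24 * D'\<^sup>2 + 1/4 * (D' * P) - 7/16 * P\<^sup>2 - 3/8 * D\<^sup>2 \<le> - (1/20) * (P\<^sup>2 + D\<^sup>2)"
proof -
  have D': "D' \<le> (P + 2 * D) / 7" using assms by simp
  have "D'\<^sup>2 \<le> ((P + 2 * D) / 7)\<^sup>2" using D' assms by (intro power_mono)
  then have 1: "49 * D'\<^sup>2 \<le> P\<^sup>2 + 4 * (P * D) + 4 * D\<^sup>2" by (simp add: power2_eq_square algebra_simps)
  have 2: "7 * (D' * P) \<le> P\<^sup>2 + 2 * (P * D)"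
    using mult_right_mono[OF assms(4,1)] by (simp add: power2_eq_square algebra_simps)
  have "0 \<le> (P - D)\<^sup>2" by simp
  then have 3: "2 * (P * D) \<le> P\<^sup>2 + D\<^sup>2" by (simp add: power2_diff)
  have "0 \<le> P\<^sup>2" "0 \<le> D\<^sup>2" by auto
  with 1 2 3 show ?thesis by argo
qed

section \<open>Sharp-peak functions and the penalty\<close>

text \<open>A quadratic minorant touching at \<open>t0\<close> has an error \<open>K (t - t0)\<^sup>2\<close>, which is \<open>o(\<bar>t - t0\<bar>)\<close>.  Because
  \<open>t0\<close> is interior to \<open>[0,1]\<close>, the minorant holds in a full neighbourhood, whatever \<open>g\<close> does outside the
  interval.\<close>
lemma interior_quadratic_minorant_limiting_subdiff:
  fixes g :: "real \<Rightarrow> ereal"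
  assumes gr: "g t0 = ereal r" and t0: "0 < t0" "t0 < 1"
    and minor: "\<And>t. t \<in> {0..1} \<Longrightarrow> ereal (r + \<nu> * (t - t0) - K * (t - t0)\<^sup>2) \<le> g t"
  shows "\<nu> \<in> limiting_subdiff g t0"
proof -
  have "\<forall>\<^sub>F t in nhds t0. g t0 + ereal (\<nu> \<bullet> (t - t0) - e * norm (t - t0)) \<le> g t" if "0 < e" for e
  proof -
    have "\<forall>\<^sub>F t in nhds t0. t \<in> {0<..<1}" by (rule eventually_nhds_in_open) (use t0 in auto)
    moreover have "((\<lambda>t. K * \<bar>t - t0\<bar>) \<longlongrightarrow> K * \<bar>t0 - t0\<bar>) (nhds t0)"
      by (intro tendsto_intros filterlim_ident)
    then have "\<forall>\<^sub>F t in nhds t0. K * \<bar>t - t0\<bar> < e" by (rule order_tendstoD) (use that in simp)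
    ultimately show ?thesis
    proof eventually_elim
      case (elim t)
      have "K * (t - t0)\<^sup>2 = (K * \<bar>t - t0\<bar>) * \<bar>t - t0\<bar>" by (simp add: power2_eq_square mult.assoc)
      also have "\<dots> \<le> e * \<bar>t - t0\<bar>" using elim by (intro mult_right_mono) auto
      finally have "ereal (r + (\<nu> * (t - t0) - e * \<bar>t - t0\<bar>)) \<le> ereal (r + \<nu> * (t - t0) - K * (t - t0)\<^sup>2)"
        by simp
      also have "\<dots> \<le> g t" using elim by (intro minor) auto
      finally show ?case by (simp add: gr)
    qed
  qed
  then have reg: "\<nu> \<in> regular_subdiff g t0" by (simp add: regular_subdiff_def gr)
  then show ?thesis unfolding limiting_subdiff_def
    by (simp add: gr) (rule exI[of _ "\<lambda>_. t0"], simp add: gr, rule exI[of _ "\<lambda>_. \<nu>"], simp)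
qed

lemma sum_Liminf_le:
  fixes h :: "'i \<Rightarrow> 'b \<Rightarrow> ereal"
  assumes "finite I" "F \<noteq> bot" and nn: "\<And>i k. i \<in> I \<Longrightarrow> 0 \<le> h i k"
  shows "(\<Sum>i\<in>I. Liminf F (h i)) \<le> Liminf F (\<lambda>k. \<Sum>i\<in>I. h i k)"
  using assms(1) nn
proof (induction I rule: finite_induct)
  case empty
  then show ?case using \<open>F \<noteq> bot\<close> by (simp add: Liminf_const)
next
  case (insert j I)
  have "Liminf F (h j) + (\<Sum>i\<in>I. Liminf F (h i))
      \<le> Liminf F (h j) + Liminf F (\<lambda>k. \<Sum>i\<in>I. h i k)"
    using insert by (intro add_left_mono) auto
  also have "\<dots> \<le> Liminf F (\<lambda>k. h j k + (\<Sum>i\<in>I. h i k))"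
    using insert.prems \<open>F \<noteq> bot\<close> by (intro Liminf_add_le always_eventually allI sum_nonneg) auto
  finally show ?case using insert by simp
qed

lemma penalty_lsc:
  fixes v :: "nat \<Rightarrow> real ^ 'n"
  assumes spf: "sharp_peak_fun g c" and v: "\<And>k. v k \<in> unit_cube" "v \<longlonglongrightarrow> z"
  shows "penalty g z \<le> liminf (\<lambda>k. penalty g (v k))"
proof -
  have z: "z \<in> unit_cube"
    using closed_sequentially[OF compact_imp_closed[OF compact_unit_cube]] v by blast
  \<comment> \<open>The filter \<open>at (z $ i) within {0..1}\<close> omits the point itself, at which \<open>a < g (z $ i)\<close> holds anyway;
    hence the sequence may hit \<open>z $ i\<close>.\<close>
  have lsc: "g (z $ i) \<le> liminf (\<lambda>k. g (v k $ i))" for i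
    unfolding le_Liminf_iff
  proof (intro allI impI)
    fix a assume a: "a < g (z $ i)"
    have "z $ i \<in> {0..1}" using z by (simp add: unit_cube_def)
    then have "g (z $ i) \<le> Liminf (at (z $ i) within {0..1}) g"
      using spf by (simp add: sharp_peak_fun_def)
    with a have "\<forall>\<^sub>F t in at (z $ i) within {0..1}. a < g t" by (simp add: le_Liminf_iff)
    then have "\<forall>\<^sub>F t in nhds (z $ i). t \<in> {0..1} \<longrightarrow> a < g t"
      unfolding eventually_at_filter by (rule eventually_mono) (use a in auto)
    moreover have "(\<lambda>k. v k $ i) \<longlonglongrightarrow> z $ i" using v by (intro tendsto_intros)
    ultimately have "\<forall>\<^sub>F k in sequentially. v k $ i \<in> {0..1} \<longrightarrow> a < g (v k $ i)"
      unfolding filterlim_iff by blast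
    then show "\<forall>\<^sub>F k in sequentially. a < g (v k $ i)" using v by (simp add: unit_cube_def)
  qed
  have "penalty g z \<le> (\<Sum>i\<in>UNIV. liminf (\<lambda>k. g (v k $ i)))"
    unfolding penalty_def by (intro sum_mono lsc)
  also have "\<dots> \<le> liminf (\<lambda>k. penalty g (v k))"
    unfolding penalty_def using spf v
    by (intro sum_Liminf_le) (auto simp: sharp_peak_fun_def unit_cube_def)
  finally show ?thesis .
qed

lemma penalty_split:
  "penalty g v = g (v $ i) + (\<Sum>j\<in>UNIV - {i}. g (v $ j))"
  unfolding penalty_def by (simp add: sum.remove[of UNIV i])

lemma penalty_nonneg: "sharp_peak_fun g c \<Longrightarrow> v \<in> unit_cube \<Longrightarrow> 0 \<le> penalty g v"
  unfolding penalty_def by (intro sum_nonneg) (auto simp: sharp_peak_fun_def unit_cube_def)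

lemma penalty_binary_eq_0:
  assumes "sharp_peak_fun g c" and v: "v \<in> binary_points" shows "penalty g v = 0"
proof -
  have "g (v $ i) = 0" for i
  proof -
    have "v $ i \<in> {0, 1}" using v by (simp add: binary_points_def)
    then show ?thesis using assms(1) by (auto simp: sharp_peak_fun_def)
  qed
  then show ?thesis by (simp add: penalty_def)
qed

section \<open>Runs of the algorithm\<close>

locale shapeak_run =
  fixes f :: "real ^ 'n \<Rightarrow> real" and G :: "real ^ 'n \<Rightarrow> real ^ 'n"
    and g :: "real \<Rightarrow> ereal"
    and Q :: "nat \<Rightarrow> real ^ 'n ^ 'n"
    and w x y :: "nat \<Rightarrow> real ^ 'n" and \<mu> :: "nat \<Rightarrow> real"
    and c \<mu>\<^sub>0 \<sigma> \<eta> \<rho> \<epsilon> lam \<beta> :: real and k\<^sub>0 :: nat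
  assumes grad: "\<And>z. GDERIV f z :> G z"
    and grad_cont: "continuous_on UNIV G"
    and spf: "sharp_peak_fun g c"
    and params: "\<mu>\<^sub>0 > 0" "\<sigma> > 0" "\<eta> > 1" "0 < \<rho>" "\<rho> \<le> 1 / 6" "\<epsilon> > 0"
    and beta: "\<beta>-lipschitz_on (region_N f \<sigma> (w 0)) G"
    and seq: "ShaPeak_sequence g G \<mu>\<^sub>0 \<sigma> \<eta> \<rho> \<epsilon> k\<^sub>0 Q w x y \<mu>"
    and Q_psd: "\<And>k v. 0 \<le> v \<bullet> (Q k *v v)"
    and Q_norm: "\<And>k. onorm ((*v) (Q k)) \<le> lam"
    and sigma: "\<sigma> \<ge> 8 * max lam \<beta>"
begin

definition \<phi> :: "nat \<Rightarrow> real" where "\<phi> k = real_of_ereal (penalty g (w k))"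

definition gap :: "nat \<Rightarrow> real" where "gap k = norm (x k - w k)"

definition move :: "nat \<Rightarrow> real" where "move k = norm (x (Suc k) - x k)"

definition Lag :: "nat \<Rightarrow> real" where
  "Lag k = f (x k) + \<mu> k * \<phi> k + y k \<bullet> (x k - w k) + \<sigma> / 2 * (gap k)\<^sup>2"

text \<open>The potential that decreases.  The dual step raises \<open>Lag\<close> by a multiple of \<open>(gap (k + 1))\<^sup>2\<close>, and
  \<open>gap (k + 1)\<close> is controlled by \<open>gap k\<close> and \<open>move k\<close>; the additional term pays for the \<open>gap k\<close> part.\<close>
definition merit :: "nat \<Rightarrow> real" where "merit k = Lag k + 3 * \<sigma> / 8 * (gap k)\<^sup>2"

abbreviation "region \<equiv> region_N f \<sigma> (w 0)"

abbreviation "f_min \<equiv> INF u\<in>unit_cube. f u"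

lemma gap_nonneg: "0 \<le> gap k" and move_nonneg: "0 \<le> move k"
  by (simp_all add: gap_def move_def)

lemma w0: "w 0 = x 0" "w 0 \<in> binary_points" "y 0 = - G (w 0)" "\<mu> 0 = \<mu>\<^sub>0"
  using seq by (auto simp: ShaPeak_sequence_def)

lemma w_argmin:
  "is_arg_min (\<lambda>u. ereal (\<mu> k) * penalty g u + ereal (y k \<bullet> (x k - u) + \<sigma> / 2 * (norm (x k - u))\<^sup>2))
     (\<lambda>u. u \<in> unit_cube) (w (Suc k))"
  using seq by (simp add: ShaPeak_sequence_def)

lemma w_cube: "w k \<in> unit_cube"
  using w_argmin w0 binary_points_subset_cube by (cases k) (auto simp: is_arg_min_def)

lemma w_step_ereal:
  "u \<in> unit_cube \<Longrightarrow>
    ereal (\<mu> k) * penalty g (w (Suc k)) + ereal (y k \<bullet> (x k - w (Suc k)) + \<sigma> / 2 * (norm (x k - w (Suc k)))\<^sup>2)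
    \<le> ereal (\<mu> k) * penalty g u + ereal (y k \<bullet> (x k - u) + \<sigma> / 2 * (norm (x k - u))\<^sup>2)"
  using w_argmin[of k] by (auto simp: is_arg_min_def not_less)

lemma penalty_eq_phi_if_finite:
  "penalty g (w k) \<noteq> \<infinity> \<Longrightarrow> penalty g (w k) = ereal (\<phi> k) \<and> 0 \<le> \<phi> k"
  using penalty_nonneg[OF spf w_cube, of k] unfolding \<phi>_def by (cases "penalty g (w k)") auto

text \<open>The second argument of the minimum in the update of \<open>\<mu>\<close> is a bound on the increment that makes it
  cheap: multiplied by \<open>\<phi> + \<epsilon>\<close> it costs at most a small multiple of \<open>gap\<^sup>2\<close>.\<close>
lemma mu_update:
  assumes fin: "penalty g (w (Suc k)) \<noteq> \<infinity>" and "0 < \<mu> k"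
  shows "\<exists>\<delta>. \<mu> (Suc k) = \<mu> k + \<delta> \<and> 0 \<le> \<delta> \<and> \<delta> * (\<phi> (Suc k) + \<epsilon>) \<le> \<rho> * \<sigma> * (gap (Suc k))\<^sup>2"
proof -
  let ?A = "(\<eta> - 1) * \<mu> k" and ?B = "\<rho> * \<sigma> * (gap (Suc k))\<^sup>2"
  note pen = penalty_eq_phi_if_finite[OF fin]
  have pos: "0 < \<phi> (Suc k) + \<epsilon>" using pen params by simp
  have "?A \<ge> 0" "?B \<ge> 0" using params assms by auto
  have "\<forall>k\<ge>1. ereal (\<mu> k) =
        (if k\<^sub>0 dvd k \<and> penalty g (w k) \<noteq> 0
         then ereal (\<mu> (k - 1)) +
           min (ereal ((\<eta> - 1) * \<mu> (k - 1)))
               (ereal (\<rho> * \<sigma> * (norm (x k - w k))\<^sup>2) / (penalty g (w k) + ereal \<epsilon>))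
         else ereal (\<mu> (k - 1)))"
    using seq by (simp add: ShaPeak_sequence_def)
  from this[rule_format, of "Suc k"]
  have "ereal (\<mu> (Suc k)) =
        (if k\<^sub>0 dvd Suc k \<and> penalty g (w (Suc k)) \<noteq> 0
         then ereal (\<mu> k + min ?A (?B / (\<phi> (Suc k) + \<epsilon>))) else ereal (\<mu> k))"
    using pen pos by (simp add: gap_def min_def)
  then consider "\<mu> (Suc k) = \<mu> k + min ?A (?B / (\<phi> (Suc k) + \<epsilon>))" | "\<mu> (Suc k) = \<mu> k + 0"
    by (auto split: if_splits)
  then show ?thesis
  proof cases
    case 1
    have "min ?A (?B / (\<phi> (Suc k) + \<epsilon>)) * (\<phi> (Suc k) + \<epsilon>)
        \<le> ?B / (\<phi> (Suc k) + \<epsilon>) * (\<phi> (Suc k) + \<epsilon>)"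
      using pos by (intro mult_right_mono) auto
    with 1 pos \<open>?A \<ge> 0\<close> \<open>?B \<ge> 0\<close> show ?thesis by (intro exI[of _ "min ?A (?B / (\<phi> (Suc k) + \<epsilon>))"]) auto
  qed (use \<open>?B \<ge> 0\<close> in auto)
qed

text \<open>The two facts depend on each other.  With \<open>\<mu> k > 0\<close>, an infinite penalty at \<open>w (k + 1)\<close> would give
  an infinite objective, although the binary point \<open>w 0\<close> has a finite one; and with a finite penalty the
  update of \<open>\<mu>\<close> can be read in the reals.\<close>
lemma mu_pos_and_penalty_finite: "0 < \<mu> k \<and> penalty g (w k) \<noteq> \<infinity>"
proof (induction k)
  case 0
  then show ?case using w0(4) params penalty_binary_eq_0[OF spf w0(2)] by simp
next
  case (Suc k)
  have "ereal (\<mu> k) * penalty g (w (Suc k)) \<noteq> \<infinity>"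
    using w_step_ereal[of "w 0" k] penalty_binary_eq_0[OF spf w0(2)]
      binary_points_subset_cube w0(2) by auto
  then have "penalty g (w (Suc k)) \<noteq> \<infinity>" using Suc by auto
  moreover from mu_update[OF this] Suc obtain \<delta> where "\<mu> (Suc k) = \<mu> k + \<delta>" "0 \<le> \<delta>" by blast
  ultimately show ?case using Suc by simp
qed

lemmas mu_pos = mu_pos_and_penalty_finite[THEN conjunct1]

lemma penalty_eq_phi: "penalty g (w k) = ereal (\<phi> k)" and phi_nonneg: "0 \<le> \<phi> k"
  using penalty_eq_phi_if_finite mu_pos_and_penalty_finite by blast+

lemma w_step:
  assumes "u \<in> unit_cube" "penalty g u = ereal r"
  shows "\<mu> k * \<phi> (Suc k) + y k \<bullet> (x k - w (Suc k)) + \<sigma> / 2 * (norm (x k - w (Suc k)))\<^sup>2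
    \<le> \<mu> k * r + y k \<bullet> (x k - u) + \<sigma> / 2 * (norm (x k - u))\<^sup>2"
  using w_step_ereal[OF assms(1), of k] by (simp add: assms(2) penalty_eq_phi)

lemma mu_increment:
  "\<mu> k \<le> \<mu> (Suc k)"
  "(\<mu> (Suc k) - \<mu> k) * \<phi> (Suc k) \<le> \<sigma> / 6 * (gap (Suc k))\<^sup>2"
  "(\<mu> (Suc k) - \<mu> k) * \<epsilon> \<le> \<rho> * \<sigma> * (gap (Suc k))\<^sup>2"
proof -
  obtain \<delta> where \<delta>: "\<mu> (Suc k) = \<mu> k + \<delta>" "0 \<le> \<delta>" "\<delta> * (\<phi> (Suc k) + \<epsilon>) \<le> \<rho> * \<sigma> * (gap (Suc k))\<^sup>2"
    using mu_update[of k] mu_pos_and_penalty_finite by blast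
  have nn: "0 \<le> \<delta> * \<phi> (Suc k)" "0 \<le> \<delta> * \<epsilon>" using \<delta> phi_nonneg params by auto
  have "\<rho> * \<sigma> * (gap (Suc k))\<^sup>2 \<le> 1 / 6 * \<sigma> * (gap (Suc k))\<^sup>2"
    using params by (intro mult_right_mono) auto
  with \<delta> nn show "\<mu> k \<le> \<mu> (Suc k)" "(\<mu> (Suc k) - \<mu> k) * \<phi> (Suc k) \<le> \<sigma> / 6 * (gap (Suc k))\<^sup>2"
    "(\<mu> (Suc k) - \<mu> k) * \<epsilon> \<le> \<rho> * \<sigma> * (gap (Suc k))\<^sup>2" by (simp_all add: algebra_simps)
qed

text \<open>Eliminating the inverse matrix shows that the multiplier is, up to \<open>Q (x - w)\<close>, the negative
  gradient at \<open>w\<close>.  Differences of multipliers are therefore controlled by the Lipschitz constant.\<close>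
lemma y_eq: "y k = - G (w k) - Q k *v (x k - w k)"
proof (cases k)
  case 0
  then show ?thesis using w0 by simp
next
  case (Suc m)
  have "x k - w k = - (matrix_inv (mat \<sigma> + Q k) *v (G (w k) + y m))"
    using seq Suc by (simp add: ShaPeak_sequence_def)
  then have "(mat \<sigma> + Q k) *v (x k - w k) = - (G (w k) + y m)"
    using shifted_psd_matrix_inv[OF params(2) Q_psd, of k "G (w k) + y m"]
    by (simp only: linear_neg[OF matrix_vector_mul_linear])
  then have "\<sigma> *\<^sub>R (x k - w k) + Q k *v (x k - w k) = - (G (w k) + y m)"
    by (simp add: matrix_vector_mult_add_rdistrib mat_mult_vec)
  moreover have "y k = y m + \<sigma> *\<^sub>R (x k - w k)"
    using seq Suc by (simp add: ShaPeak_sequence_def)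
  ultimately have "y k + Q k *v (x k - w k) = - G (w k)"
    by (metis (no_types, opaque_lifting) add.assoc add.commute add_left_cancel add.left_inverse minus_add)
  then show ?thesis by (simp only: eq_diff_eq)
qed

lemma y_step: "y (Suc k) = y k + \<sigma> *\<^sub>R (x (Suc k) - w (Suc k))"
  using seq by (simp add: ShaPeak_sequence_def)

lemma sigma_bounds: "8 * lam \<le> \<sigma>" "8 * \<beta> \<le> \<sigma>"
  using sigma by auto

lemma Q_bound: "norm (Q k *v v) \<le> \<sigma> / 8 * norm v"
proof -
  have "norm (Q k *v v) \<le> onorm ((*v) (Q k)) * norm v"
    by (rule onorm) (rule matrix_vector_mul_bounded_linear)
  also have "\<dots> \<le> \<sigma> / 8 * norm v"
    using order_trans[OF Q_norm, of "\<sigma> / 8"] sigma_bounds by (intro mult_right_mono) auto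
  finally show ?thesis .
qed

lemma cont_f: "continuous_on S f"
  using grad unfolding gderiv_def
  by (meson continuous_at_imp_continuous_on has_derivative_continuous)

lemma f_min_le: "u \<in> unit_cube \<Longrightarrow> f_min \<le> f u"
  by (intro cINF_lower bounded_imp_bdd_below compact_imp_bounded
      compact_continuous_image cont_f compact_unit_cube)

lemma alpha_nonneg: "0 \<le> alpha_const f \<sigma> (w 0)"
  using f_min_le[OF w_cube[of 0]] params by (simp add: alpha_const_def)

lemma convex_region: "convex region"
  unfolding region_N_def by (rule convex_infnorm_ball)

lemma near_w_in_region:
  assumes "norm (z - w k) \<le> (sqrt (real CARD('n)) + sqrt (alpha_const f \<sigma> (w 0))) / 8"
  shows "z \<in> region"
proof -
  have "infnorm z \<le> infnorm (w k) + infnorm (z - w k)"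
    using infnorm_triangle[of "w k" "z - w k"] by simp
  also have "\<dots> \<le> 1 + norm (z - w k)"
    by (intro add_mono infnorm_cube_le w_cube infnorm_le_norm)
  finally have "infnorm z \<le> 1 + (sqrt (real CARD('n)) + sqrt (alpha_const f \<sigma> (w 0))) / 8"
    using assms by linarith
  then show ?thesis by (simp add: region_N_def)
qed

lemma w_region: "w k \<in> region"
  using near_w_in_region[of "w k" k] alpha_nonneg by simp

lemma G_lipschitz:
  assumes "a \<in> region" "b \<in> region" shows "norm (G a - G b) \<le> \<sigma> / 8 * norm (a - b)"
proof -
  have "norm (G a - G b) \<le> \<beta> * norm (a - b)"
    using lipschitz_onD[OF beta assms] by (simp add: dist_norm)
  also have "\<dots> \<le> \<sigma> / 8 * norm (a - b)" using sigma_bounds by (intro mult_right_mono) auto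
  finally show ?thesis .
qed

lemma f_lower_bound:
  assumes "a \<in> region" "b \<in> region"
  shows "f a + G a \<bullet> (b - a) - \<sigma> / 16 * (norm (b - a))\<^sup>2 \<le> f b"
proof -
  have "\<beta> / 2 * (norm (b - a))\<^sup>2 \<le> \<sigma> / 16 * (norm (b - a))\<^sup>2"
    using sigma_bounds by (intro mult_right_mono) auto
  then show ?thesis
    using lipschitz_gradient_lower_bound[OF grad beta convex_region assms] by simp
qed

section \<open>Descent of the potential\<close>

text \<open>Since \<open>y (k + 1) - y k = \<sigma> (x (k + 1) - w (k + 1))\<close>, inserting the formula for \<open>y\<close> on the left
  expresses the next gap by a gradient difference and the previous gap, with factors at most \<open>\<sigma>/8\<close>.  Both
  gradients are taken at points of the cube, so the bound is available before \<open>x (k + 1)\<close> is known to lie in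
  the region.\<close>
lemma gap_step: "8 * gap (Suc k) \<le> norm (w (Suc k) - w k) + gap k"
proof -
  let ?d = "\<lambda>k. x k - w k"
  have "\<sigma> *\<^sub>R ?d (Suc k) + Q (Suc k) *v ?d (Suc k) = (G (w k) - G (w (Suc k))) + Q k *v ?d k"
    using y_step[of k] unfolding y_eq[of "Suc k"] y_eq[of k] by (simp add: algebra_simps)
  then have "\<sigma> * gap (Suc k) \<le> norm ((G (w k) - G (w (Suc k))) + Q k *v ?d k)"
    using shifted_psd_norm_le[OF Q_psd, of \<sigma> "?d (Suc k)"] by (metis gap_def)
  also have "\<dots> \<le> norm (G (w k) - G (w (Suc k))) + norm (Q k *v ?d k)" by (rule norm_triangle_ineq)
  also have "\<dots> \<le> \<sigma> / 8 * norm (w k - w (Suc k)) + \<sigma> / 8 * gap k"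
    unfolding gap_def by (intro add_mono G_lipschitz w_region Q_bound)
  finally have "\<sigma> * (8 * gap (Suc k)) \<le> \<sigma> * (norm (w (Suc k) - w k) + gap k)"
    by (simp add: algebra_simps norm_minus_commute)
  then show ?thesis using params by simp
qed

text \<open>The \<open>w\<close>-step has no strong convexity to offer, as the penalty need not be convex, so the move of \<open>w\<close> is
  eliminated in favour of the move of \<open>x\<close>.\<close>
lemma gap_step_move: "7 * gap (Suc k) \<le> move k + 2 * gap k"
proof -
  have "w (Suc k) - w k = (x (Suc k) - x k) - (x (Suc k) - w (Suc k)) + (x k - w k)" by simp
  also have "norm \<dots> \<le> norm ((x (Suc k) - x k) - (x (Suc k) - w (Suc k))) + gap k"
    unfolding gap_def by (rule norm_triangle_ineq)
  also have "\<dots> \<le> move k + gap (Suc k) + gap k"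
    unfolding gap_def move_def by (intro add_mono norm_triangle_ineq4 order_refl)
  finally show ?thesis using gap_step[of k] by simp
qed

text \<open>Inserting the formula for \<open>y\<close> turns \<open>f x + y \<bullet> (x - w)\<close> into the linearisation error of \<open>f\<close> at \<open>w\<close>,
  the value \<open>f w\<close> and the form \<open>(x - w) \<bullet> Q (x - w)\<close>; the errors, at most \<open>\<sigma>/16\<close> and \<open>\<sigma>/8\<close> times the squared
  gap, leave \<open>5\<sigma>/16\<close> of the coefficient \<open>\<sigma>/2\<close> of the quadratic term.\<close>
lemma Lag_lower:
  assumes "x k \<in> region"
  shows "f_min + 5 * \<sigma> / 16 * (gap k)\<^sup>2 \<le> Lag k"
proof -
  let ?d = "x k - w k"
  have "(Q k *v ?d) \<bullet> ?d \<le> norm (Q k *v ?d) * norm ?d" by (rule norm_cauchy_schwarz)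
  also have "\<dots> \<le> (\<sigma> / 8 * norm ?d) * norm ?d" by (intro mult_right_mono Q_bound) simp
  finally have "(Q k *v ?d) \<bullet> ?d \<le> \<sigma> / 8 * (gap k)\<^sup>2" by (simp add: gap_def power2_eq_square)
  moreover have "y k \<bullet> ?d = - (G (w k) \<bullet> ?d) - (Q k *v ?d) \<bullet> ?d"
    by (subst y_eq) (simp only: inner_diff_left inner_minus_left)
  moreover have "f (w k) + G (w k) \<bullet> ?d - \<sigma> / 16 * (gap k)\<^sup>2 \<le> f (x k)"
    unfolding gap_def by (rule f_lower_bound[OF w_region assms])
  moreover have "f_min \<le> f (w k)" by (rule f_min_le[OF w_cube])
  moreover have "0 \<le> \<mu> k * \<phi> k" using mu_pos[of k] phi_nonneg[of k] by simp
  ultimately show ?thesis by (simp add: Lag_def)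
qed

text \<open>As a function of \<open>x\<close>, the augmented Lagrangian is strongly convex with modulus at least \<open>7/8 \<sigma>\<close> on the
  region, and its gradient at \<open>x (k + 1)\<close> is \<open>?r\<close> below, of norm at most \<open>\<sigma>/4\<close> times the gap.  The new point is
  thus an approximate minimiser, better than \<open>x k\<close> by a multiple of the squared move, up to an error of the
  order of gap times move.\<close>
lemma x_step:
  assumes "x k \<in> region" "x (Suc k) \<in> region"
  shows "f (x (Suc k)) + y k \<bullet> (x (Suc k) - w (Suc k)) + \<sigma> / 2 * (gap (Suc k))\<^sup>2
    \<le> f (x k) + y k \<bullet> (x k - w (Suc k)) + \<sigma> / 2 * (norm (x k - w (Suc k)))\<^sup>2
      + \<sigma> * (gap (Suc k) * move k / 4 - 7 / 16 * (move k)\<^sup>2)"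
proof -
  let ?d = "x (Suc k) - w (Suc k)" and ?p = "x (Suc k) - x k"
  let ?r = "G (x (Suc k)) + y (Suc k)"
  have "?r = (G (x (Suc k)) - G (w (Suc k))) - Q (Suc k) *v ?d" by (simp add: y_eq)
  then have "norm ?r \<le> norm (G (x (Suc k)) - G (w (Suc k))) + norm (Q (Suc k) *v ?d)"
    by (metis norm_triangle_ineq4)
  also have "\<dots> \<le> \<sigma> / 8 * norm ?d + \<sigma> / 8 * norm ?d"
    by (intro add_mono G_lipschitz Q_bound assms w_region)
  finally have "norm ?r * move k \<le> (\<sigma> / 4 * gap (Suc k)) * move k"
    unfolding gap_def by (intro mult_right_mono move_nonneg) simp
  with norm_cauchy_schwarz[of ?r ?p]
  have r: "?r \<bullet> ?p \<le> \<sigma> * (gap (Suc k) * move k / 4)" by (simp add: move_def)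
  have low: "f (x (Suc k)) - G (x (Suc k)) \<bullet> ?p - \<sigma> / 16 * (move k)\<^sup>2 \<le> f (x k)"
    using f_lower_bound[OF assms(2,1)]
    by (simp add: move_def norm_minus_commute inner_diff_right)
  have "x k - w (Suc k) = ?d - ?p" by simp
  then have "(norm (x k - w (Suc k)))\<^sup>2 = (gap (Suc k))\<^sup>2 - 2 * (?d \<bullet> ?p) + (move k)\<^sup>2"
    unfolding gap_def move_def by (simp only: power2_norm_eq_inner) (simp add: inner_diff_left inner_diff_right inner_commute)
  moreover have "\<sigma> / 2 * (A - 2 * B + C) = \<sigma> / 2 * A - \<sigma> * B + \<sigma> / 2 * C" for A B C
    by (simp add: algebra_simps)
  ultimately have "\<sigma> / 2 * (norm (x k - w (Suc k)))\<^sup>2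
      = \<sigma> / 2 * (gap (Suc k))\<^sup>2 - \<sigma> * (?d \<bullet> ?p) + \<sigma> / 2 * (move k)\<^sup>2"
    by simp
  moreover have "y k \<bullet> (x k - w (Suc k)) = y k \<bullet> ?d - y k \<bullet> ?p" by (simp add: inner_diff_right)
  moreover have "?r \<bullet> ?p = G (x (Suc k)) \<bullet> ?p + y k \<bullet> ?p + \<sigma> * (?d \<bullet> ?p)"
    by (simp only: y_step inner_add_left inner_scaleR_left)
  moreover have "\<sigma> * (gap (Suc k) * move k / 4 - 7 / 16 * (move k)\<^sup>2)
      = \<sigma> * (gap (Suc k) * move k / 4) - 7 / 8 * (\<sigma> / 2 * (move k)\<^sup>2)" by (simp add: algebra_simps)
  moreover have "\<sigma> / 16 * (move k)\<^sup>2 = 1 / 8 * (\<sigma> / 2 * (move k)\<^sup>2)" by simp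
  ultimately show ?thesis using r low by linarith
qed

text \<open>The changes along one iteration add up: the step in \<open>w\<close> does not increase the Lagrangian, the step in
  \<open>x\<close> changes it as estimated in \<open>x_step\<close>, the step in \<open>y\<close> raises it by \<open>\<sigma> (gap (k + 1))\<^sup>2\<close>, and the step in \<open>\<mu>\<close> by at most a
  sixth of that.\<close>
lemma merit_descent:
  assumes "x k \<in> region" "x (Suc k) \<in> region"
  shows "merit (Suc k) \<le> merit k - \<sigma> / 20 * ((move k)\<^sup>2 + (gap k)\<^sup>2)"
proof -
  let ?d = "x (Suc k) - w (Suc k)"
  have "\<mu> k * \<phi> (Suc k) + y k \<bullet> (x k - w (Suc k)) + \<sigma> / 2 * (norm (x k - w (Suc k)))\<^sup>2
    \<le> \<mu> k * \<phi> k + y k \<bullet> (x k - w k) + \<sigma> / 2 * (gap k)\<^sup>2"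
    unfolding gap_def by (rule w_step[OF w_cube penalty_eq_phi])
  moreover have "y (Suc k) \<bullet> ?d = y k \<bullet> ?d + \<sigma> * (gap (Suc k))\<^sup>2"
    by (simp add: y_step inner_add_left gap_def power2_norm_eq_inner)
  moreover have "\<mu> (Suc k) * \<phi> (Suc k) \<le> \<mu> k * \<phi> (Suc k) + \<sigma> / 6 * (gap (Suc k))\<^sup>2"
    using mu_increment(2)[of k] by (simp add: algebra_simps)
  moreover note x_step[OF assms]
  ultimately have "merit (Suc k) \<le> merit k + \<sigma> * (37/24 * (gap (Suc k))\<^sup>2 + 1/4 * (gap (Suc k) * move k)
      - 7/16 * (move k)\<^sup>2 - 3/8 * (gap k)\<^sup>2)"
    unfolding merit_def Lag_def by (simp add: algebra_simps)
  also have "\<dots> \<le> merit k + \<sigma> * (- (1/20) * ((move k)\<^sup>2 + (gap k)\<^sup>2))"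
    using params by (intro add_left_mono mult_left_mono descent_arith move_nonneg gap_nonneg gap_step_move) auto
  finally show ?thesis by (simp add: algebra_simps)
qed

lemma merit_lower:
  assumes "x k \<in> region" shows "f_min + \<sigma> / 2 * (gap k)\<^sup>2 \<le> merit k"
proof -
  have "0 \<le> \<sigma> * (gap k)\<^sup>2" using params by simp
  then show ?thesis using Lag_lower[OF assms] unfolding merit_def by (simp add: field_simps)
qed

text \<open>Descent is only available inside the region, and staying inside is a consequence of descent, so both
  are proved together.  The potential is at most its initial value \<open>f (w 0)\<close>, hence
  \<open>(gap k)\<^sup>2 \<le> alpha_const f \<sigma> (w 0)\<close>; the next gap is at most one eighth of \<open>sqrt n + gap k\<close>,
  hence at most the margin by which the region exceeds the cube.\<close>
lemma x_in_region_and_merit_le: "x k \<in> region \<and> merit k \<le> f (w 0)"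
proof (induction k)
  case 0
  have "\<phi> 0 = 0" using penalty_binary_eq_0[OF spf w0(2)] by (simp add: \<phi>_def)
  then show ?case using w0(1) w_region[of 0] by (simp add: merit_def Lag_def gap_def)
next
  case (Suc k)
  have "(gap k)\<^sup>2 \<le> alpha_const f \<sigma> (w 0)"
    using merit_lower[of k] Suc params by (simp add: alpha_const_def field_simps)
  then have "gap k \<le> sqrt (alpha_const f \<sigma> (w 0))" using gap_nonneg real_le_rsqrt by blast
  moreover have "norm (w (Suc k) - w k) \<le> sqrt (real CARD('n))" by (intro cube_diff_norm_le w_cube)
  ultimately have "gap (Suc k) \<le> (sqrt (real CARD('n)) + sqrt (alpha_const f \<sigma> (w 0))) / 8"
    using gap_step[of k] by simp
  then have reg: "x (Suc k) \<in> region" unfolding gap_def by (rule near_w_in_region)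
  moreover have "0 \<le> \<sigma> / 20 * ((move k)\<^sup>2 + (gap k)\<^sup>2)" using params by simp
  ultimately show ?case using merit_descent[of k] Suc by auto
qed

lemmas x_region = x_in_region_and_merit_le[THEN conjunct1]

section \<open>Convergence\<close>
lemma summable_squares: "summable (\<lambda>k. (move k)\<^sup>2 + (gap k)\<^sup>2)"
proof (rule summableI_nonneg_bounded)
  fix n
  have "\<sigma> / 20 * (\<Sum>k<n. (move k)\<^sup>2 + (gap k)\<^sup>2) = (\<Sum>k<n. \<sigma> / 20 * ((move k)\<^sup>2 + (gap k)\<^sup>2))"
    by (rule sum_distrib_left)
  also have "\<dots> \<le> (\<Sum>k<n. merit k - merit (Suc k))"
    using merit_descent x_region by (intro sum_mono) (smt (verit))
  also have "\<dots> = merit 0 - merit n" by (simp add: sum_lessThan_telescope')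
  also have "\<dots> \<le> merit 0 - f_min"
    using merit_lower[OF x_region, of n] params by (smt (verit) mult_nonneg_nonneg divide_nonneg_nonneg zero_le_power2)
  finally have "\<sigma> * (\<Sum>k<n. (move k)\<^sup>2 + (gap k)\<^sup>2) \<le> 20 * (merit 0 - f_min)"
    by simp
  then show "(\<Sum>k<n. (move k)\<^sup>2 + (gap k)\<^sup>2) \<le> 20 * (merit 0 - f_min) / \<sigma>"
    using params by (simp add: field_simps)
qed simp

lemma summable_gap_sq: "summable (\<lambda>k. (gap k)\<^sup>2)" and summable_move_sq: "summable (\<lambda>k. (move k)\<^sup>2)"
  by (rule summable_comparison_test'[OF summable_squares]; simp)+

lemma gap_tendsto: "gap \<longlonglongrightarrow> 0"
  using tendsto_real_sqrt[OF summable_LIMSEQ_zero[OF summable_gap_sq]] by (simp add: gap_nonneg)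

lemma move_tendsto: "move \<longlonglongrightarrow> 0"
  using tendsto_real_sqrt[OF summable_LIMSEQ_zero[OF summable_move_sq]] by (simp add: move_nonneg)

lemma d_tendsto: "(\<lambda>k. x k - w k) \<longlonglongrightarrow> 0"
  using gap_tendsto unfolding gap_def by (simp add: tendsto_norm_zero_iff)

lemma w_diff_tendsto: "(\<lambda>k. w (Suc k) - w k) \<longlonglongrightarrow> 0"
proof -
  have p: "(\<lambda>k. x (Suc k) - x k) \<longlonglongrightarrow> 0"
    using move_tendsto unfolding move_def by (simp add: tendsto_norm_zero_iff)
  have "(\<lambda>k. (x (Suc k) - x k) - (x (Suc k) - w (Suc k)) + (x k - w k)) \<longlonglongrightarrow> 0 - 0 + 0"
    by (intro tendsto_intros p d_tendsto LIMSEQ_Suc[OF d_tendsto])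
  then show ?thesis by simp
qed

lemma y_diff_tendsto: "(\<lambda>k. norm (y (Suc k) - y k)) \<longlonglongrightarrow> 0"
proof -
  have "(\<lambda>k. norm (\<sigma> *\<^sub>R (x (Suc k) - w (Suc k)))) \<longlonglongrightarrow> norm (\<sigma> *\<^sub>R (0 :: real ^ 'n))"
    by (intro tendsto_intros LIMSEQ_Suc[OF d_tendsto])
  then show ?thesis by (simp add: y_step)
qed

lemma Qd_tendsto: "(\<lambda>k. Q k *v (x k - w k)) \<longlonglongrightarrow> 0"
proof (rule Lim_null_comparison)
  show "\<forall>\<^sub>F k in sequentially. norm (Q k *v (x k - w k)) \<le> \<sigma> / 8 * gap k"
    unfolding gap_def by (intro always_eventually allI Q_bound)
  show "(\<lambda>k. \<sigma> / 8 * gap k) \<longlonglongrightarrow> 0" using gap_tendsto by (rule tendsto_mult_right_zero)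
qed

lemma merit_converges: "\<exists>l. merit \<longlonglongrightarrow> l \<and> Lag \<longlonglongrightarrow> l"
proof -
  have "decseq merit"
  proof (rule decseq_SucI)
    fix k
    have "0 \<le> \<sigma> / 20 * ((move k)\<^sup>2 + (gap k)\<^sup>2)" using params by simp
    then show "merit (Suc k) \<le> merit k" using merit_descent[OF x_region x_region, of k] by simp
  qed
  moreover have "f_min \<le> merit k" for k
  proof -
    have "0 \<le> \<sigma> / 2 * (gap k)\<^sup>2" using params by simp
    then show ?thesis using merit_lower[OF x_region, of k] by simp
  qed
  ultimately obtain l where l: "merit \<longlonglongrightarrow> l" using decseq_convergent[of merit f_min] by blast
  have "(\<lambda>k. merit k - 3 * \<sigma> / 8 * (gap k)\<^sup>2) \<longlonglongrightarrow> l - 3 * \<sigma> / 8 * 0\<^sup>2"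
    by (intro tendsto_intros l gap_tendsto)
  with l show ?thesis by (auto simp: merit_def)
qed

text \<open>Each increment of \<open>\<mu>\<close> is at most
  \<open>\<rho> \<sigma> / \<epsilon>\<close> times a squared gap, and squared gaps are summable.\<close>
lemma mu_converges: "\<exists>m. \<mu> \<longlonglongrightarrow> m \<and> 0 < m"
proof -
  have "summable (\<lambda>k. \<mu> (Suc k) - \<mu> k)"
  proof (rule summable_comparison_test')
    show "summable (\<lambda>k. \<rho> * \<sigma> / \<epsilon> * (gap (Suc k))\<^sup>2)"
      by (rule summable_mult) (subst summable_Suc_iff, rule summable_gap_sq)
    show "norm (\<mu> (Suc k) - \<mu> k) \<le> \<rho> * \<sigma> / \<epsilon> * (gap (Suc k))\<^sup>2" for k
      using mu_increment(1,3)[of k] params by (simp add: field_simps)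
  qed
  then have "(\<lambda>n. \<mu> 0 + (\<Sum>k<n. \<mu> (Suc k) - \<mu> k)) \<longlonglongrightarrow> \<mu> 0 + (\<Sum>k. \<mu> (Suc k) - \<mu> k)"
    by (intro tendsto_intros summable_LIMSEQ)
  then have lim: "\<mu> \<longlonglongrightarrow> \<mu> 0 + (\<Sum>k. \<mu> (Suc k) - \<mu> k)" by (simp add: sum_lessThan_telescope)
  have "incseq \<mu>" using mu_increment(1) by (rule incseq_SucI)
  from incseq_le[OF this lim, of 0] mu_pos[of 0] lim show ?thesis by force
qed

text \<open>The minimising property of \<open>w (k + 1)\<close> passes to the limit along a subsequence: all terms are
  continuous except the penalty at \<open>w (k + 1)\<close>, for which lower semicontinuity is the right direction.
  Since \<open>y\<close> tends to \<open>- G z\<close>, completing the square in the limit inequality gives the proximal form with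
  step \<open>1 / \<sigma>\<close>.\<close>
lemma accumulation_point_P_stationary:
  assumes mu: "\<mu> \<longlonglongrightarrow> m" "0 < m" and acc: "accumulation_point x z"
  shows "P_stationary_with g G m (1 / \<sigma>) z"
proof -
  obtain r where r: "strict_mono r" "(\<lambda>j. x (r j)) \<longlonglongrightarrow> z"
    using acc by (auto simp: accumulation_point_def o_def)
  note sub = LIMSEQ_subseq_LIMSEQ[OF _ r(1), unfolded o_def]
  have "(\<lambda>j. x (r j) - (x (r j) - w (r j))) \<longlonglongrightarrow> z - 0"
    by (intro tendsto_intros r(2) sub[OF d_tendsto])
  then have wr: "(\<lambda>j. w (r j)) \<longlonglongrightarrow> z" by simp
  have "(\<lambda>j. (w (Suc (r j)) - w (r j)) + w (r j)) \<longlonglongrightarrow> 0 + z"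
    by (intro tendsto_intros wr sub[OF w_diff_tendsto])
  then have wSr: "(\<lambda>j. w (Suc (r j))) \<longlonglongrightarrow> z" by simp
  have "isCont G z" using grad_cont by (simp add: continuous_on_eq_continuous_at)
  then have "(\<lambda>j. - G (w (r j)) - Q (r j) *v (x (r j) - w (r j))) \<longlonglongrightarrow> - G z - 0"
    by (intro tendsto_intros isCont_tendsto_compose[OF _ wr] sub[OF Qd_tendsto])
  then have yr: "(\<lambda>j. y (r j)) \<longlonglongrightarrow> - G z" by (simp flip: y_eq)
  have z: "z \<in> unit_cube"
    using closed_sequentially[OF compact_imp_closed[OF compact_unit_cube] _ wr] w_cube by blast
  have main: "penalty g z \<le> ereal (s + (- G z \<bullet> (z - u) + \<sigma> / 2 * (norm (z - u))\<^sup>2) / m)"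
    if u: "u \<in> unit_cube" and s: "penalty g u = ereal s" for u s
  proof -
    let ?b = "\<lambda>j. s + (y (r j) \<bullet> (x (r j) - u) + \<sigma> / 2 * (norm (x (r j) - u))\<^sup>2
        - y (r j) \<bullet> (x (r j) - w (Suc (r j))) - \<sigma> / 2 * (norm (x (r j) - w (Suc (r j))))\<^sup>2) / \<mu> (r j)"
    have le: "penalty g (w (Suc (r j))) \<le> ereal (?b j)" for j
    proof -
      have "\<mu> (r j) * \<phi> (Suc (r j)) \<le> \<mu> (r j) * ?b j"
        using w_step[OF u s, of "r j"] mu_pos[of "r j"] by (simp add: distrib_left)
      then show ?thesis using mu_pos[of "r j"] by (simp add: penalty_eq_phi)
    qed
    have "?b \<longlonglongrightarrow> s + (- G z \<bullet> (z - u) + \<sigma> / 2 * (norm (z - u))\<^sup>2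
        - - G z \<bullet> (z - z) - \<sigma> / 2 * (norm (z - z))\<^sup>2) / m"
      using mu by (intro tendsto_intros r(2) yr wSr sub[OF mu(1)]) auto
    then have lim: "(\<lambda>j. ereal (?b j)) \<longlonglongrightarrow> ereal (s + (- G z \<bullet> (z - u) + \<sigma> / 2 * (norm (z - u))\<^sup>2) / m)"
      by simp
    have "penalty g z \<le> liminf (\<lambda>j. penalty g (w (Suc (r j))))"
      by (rule penalty_lsc[OF spf w_cube wSr])
    also have "\<dots> \<le> liminf (\<lambda>j. ereal (?b j))"
      by (intro Liminf_mono always_eventually allI le)
    also have "\<dots> = ereal (s + (- G z \<bullet> (z - u) + \<sigma> / 2 * (norm (z - u))\<^sup>2) / m)"
      by (rule lim_imp_Liminf[OF sequentially_bot lim])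
    finally show ?thesis .
  qed
  have fin: "penalty g z \<noteq> \<infinity>"
    using main[of "w 0" 0] w_cube[of 0] penalty_binary_eq_0[OF spf w0(2)]
    by (auto simp: zero_ereal_def)
  then obtain a where a: "penalty g z = ereal a"
    using penalty_nonneg[OF spf z] by (cases "penalty g z") auto
  let ?h = "\<lambda>v. ereal (1/2 * (norm (v - (z - (1 / \<sigma>) *\<^sub>R G z)))\<^sup>2) + ereal (1 / \<sigma> * m) * penalty g v"
  have "?h z \<le> ?h u" if u: "u \<in> unit_cube" for u
  proof (cases "penalty g u")
    case (real s)
    have "a \<le> s + (- G z \<bullet> (z - u) + \<sigma> / 2 * (norm (z - u))\<^sup>2) / m"
      using main[OF u real] a by simp
    then have "m * a \<le> m * s + (G z \<bullet> (u - z) + \<sigma> / 2 * (norm (u - z))\<^sup>2)"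
      using mu(2) by (simp add: field_simps norm_minus_commute inner_diff_right)
    then have "(m * a) / \<sigma> \<le> (m * s + (G z \<bullet> (u - z) + \<sigma> / 2 * (norm (u - z))\<^sup>2)) / \<sigma>"
      using params by (intro divide_right_mono) auto
    then have le: "m * a / \<sigma> \<le> m * s / \<sigma> + G z \<bullet> (u - z) / \<sigma> + 1/2 * (norm (u - z))\<^sup>2"
      using params by (simp add: add_divide_distrib)
    have "u - (z - (1 / \<sigma>) *\<^sub>R G z) = (u - z) + (1 / \<sigma>) *\<^sub>R G z" by simp
    then have "(norm (u - (z - (1 / \<sigma>) *\<^sub>R G z)))\<^sup>2
        = (norm (u - z))\<^sup>2 + 2 * (G z \<bullet> (u - z) / \<sigma>) + (norm ((1 / \<sigma>) *\<^sub>R G z))\<^sup>2"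
      by (simp only: power2_norm_eq_inner inner_add_left inner_add_right) (simp add: inner_commute)
    then have "1/2 * (norm (z - (z - (1 / \<sigma>) *\<^sub>R G z)))\<^sup>2 + 1 / \<sigma> * m * a
        \<le> 1/2 * (norm (u - (z - (1 / \<sigma>) *\<^sub>R G z)))\<^sup>2 + 1 / \<sigma> * m * s"
      using le by (simp add: add_divide_distrib)
    then show ?thesis by (simp add: a real)
  next
    case PInf
    then show ?thesis using mu(2) params by simp
  next
    case MInf
    then show ?thesis using penalty_nonneg[OF spf u] by simp
  qed
  then show ?thesis
    using z params by (auto simp: P_stationary_with_def is_arg_min_def not_less)
qed

text \<open>Varying only the coordinate \<open>i\<close> in the minimising property of \<open>w (k + 1)\<close> leaves an inequality for
  \<open>g\<close> alone, namely a quadratic minorant touching at that coordinate.\<close>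
lemma subgradient_at_interior_coordinate:
  assumes i: "0 < w (Suc k) $ i" "w (Suc k) $ i < 1"
  shows "(y k $ i + \<sigma> * (x k $ i - w (Suc k) $ i)) / \<mu> k \<in> limiting_subdiff g (w (Suc k) $ i)"
proof -
  let ?v = "w (Suc k)"
  let ?R = "\<Sum>j\<in>UNIV - {i}. g (?v $ j)"
  have nn: "0 \<le> g t" if "t \<in> {0..1}" for t using spf that by (auto simp: sharp_peak_fun_def)
  have "0 \<le> ?R" using w_cube by (intro sum_nonneg nn) (auto simp: unit_cube_def)
  moreover have "0 \<le> g (?v $ i)" using i by (intro nn) auto
  moreover have "g (?v $ i) + ?R = ereal (\<phi> (Suc k))"
    using penalty_split[of g ?v i] by (simp add: penalty_eq_phi)
  ultimately obtain r R where r: "g (?v $ i) = ereal r" and R: "?R = ereal R" and "r + R = \<phi> (Suc k)"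
    by (cases "g (?v $ i)"; cases ?R) auto
  show ?thesis
  proof (rule interior_quadratic_minorant_limiting_subdiff[where K = "\<sigma> / (2 * \<mu> k)" and g = g, OF _ i])
    show "g (?v $ i) = ereal r" by (rule r)
  next
    fix t :: real assume t: "t \<in> {0..1}"
    define s where "s = t - ?v $ i"
    define u where "u = ?v + s *\<^sub>R axis i 1"
    have u_i: "u $ i = t" and u_j: "\<And>j. j \<noteq> i \<Longrightarrow> u $ j = ?v $ j" by (auto simp: u_def s_def axis_def)
    have u: "u \<in> unit_cube" unfolding unit_cube_def
    proof safe
      fix j show "u $ j \<in> {0..1}"
        using u_i u_j t w_cube[of "Suc k"] by (cases "j = i") (auto simp: unit_cube_def)
    qed
    show "ereal (r + (y k $ i + \<sigma> * (x k $ i - ?v $ i)) / \<mu> k * (t - ?v $ i)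
        - \<sigma> / (2 * \<mu> k) * (t - ?v $ i)\<^sup>2) \<le> g t"
    proof (cases "g t")
      case (real q)
      have "penalty g u = ereal (q + R)"
        using penalty_split[of g u i] real R u_i u_j by simp
      from w_step[OF u this, of k]
      have "\<mu> k * (r + R) + y k \<bullet> (x k - ?v) + \<sigma> / 2 * (norm (x k - ?v))\<^sup>2
        \<le> \<mu> k * (q + R) + y k \<bullet> (x k - u) + \<sigma> / 2 * (norm (x k - u))\<^sup>2"
        by (simp add: \<open>r + R = \<phi> (Suc k)\<close>)
      moreover have e: "x k - u = (x k - ?v) - s *\<^sub>R axis i 1" by (simp add: u_def)
      then have "y k \<bullet> (x k - u) = y k \<bullet> (x k - ?v) - s * y k $ i"
        by (simp only: inner_diff_right) (simp add: inner_axis)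
      moreover have "(norm (x k - u))\<^sup>2 = (norm (x k - ?v))\<^sup>2 - 2 * s * (x k $ i - ?v $ i) + s\<^sup>2"
        unfolding e power2_norm_eq_inner inner_diff_left[of "x k - ?v"] inner_diff_right[of _ "x k - ?v"]
        by (simp add: inner_axis inner_axis' power2_eq_square)
      ultimately have le: "\<mu> k * r + (y k $ i + \<sigma> * (x k $ i - ?v $ i)) * s - \<sigma> / 2 * s\<^sup>2 \<le> \<mu> k * q"
        by (simp add: algebra_simps)
      have "\<mu> k * (r + N / \<mu> k * s - \<sigma> / (2 * \<mu> k) * s\<^sup>2) = \<mu> k * r + N * s - \<sigma> / 2 * s\<^sup>2" for N
        using mu_pos[of k] by (simp add: field_simps)
      with le have "r + (y k $ i + \<sigma> * (x k $ i - ?v $ i)) / \<mu> k * s - \<sigma> / (2 * \<mu> k) * s\<^sup>2 \<le> q"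
        using mu_pos[of k] by (metis mult_le_cancel_left_pos)
      then show ?thesis by (simp add: real s_def)
    qed (use nn[OF t] in auto)
  qed
qed

text \<open>The subgradient of the previous lemma has absolute value at most
  \<open>(max infnorm G + o(1)) / \<mu> k\<close>, which is eventually smaller than \<open>c\<close>.  A sharp-peak function has no such
  subgradient, so no coordinate is interior.\<close>
lemma eventually_w_binary:
  assumes mu: "\<mu> \<longlonglongrightarrow> m" and large: "mu_bar G c < m"
  shows "\<forall>\<^sub>F k in sequentially. w (Suc k) \<in> binary_points"
proof -
  define M where "M = (SUP u\<in>unit_cube. infnorm (G u))"
  have c: "0 < c" using spf by (simp add: sharp_peak_fun_def)
  have "continuous_on unit_cube (\<lambda>u. infnorm (G u))"
    using continuous_on_subset[OF grad_cont] by (intro continuous_intros) auto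
  then have "bdd_above ((\<lambda>u. infnorm (G u)) ` unit_cube)"
    by (intro bounded_imp_bdd_above compact_imp_bounded compact_continuous_image compact_unit_cube)
  then have M: "infnorm (G u) \<le> M" if "u \<in> unit_cube" for u
    unfolding M_def using that by (intro cSUP_upper)
  \<comment> \<open>\<open>?e k\<close> is the vanishing part of the bound on \<open>\<mu> k\<close> times the subgradient.\<close>
  let ?e = "\<lambda>k. norm (Q k *v (x k - w k)) + \<sigma> * norm ((x k - w k) - (w (Suc k) - w k))"
  have "M / c < m" using large by (simp add: mu_bar_def M_def)
  then have "M + (norm (0 :: real ^ 'n) + \<sigma> * norm ((0 :: real ^ 'n) - 0)) < m * c" using c by (simp add: field_simps)
  moreover have "(\<lambda>k. \<mu> k * c - (M + ?e k))
      \<longlonglongrightarrow> m * c - (M + (norm (0 :: real ^ 'n) + \<sigma> * norm ((0 :: real ^ 'n) - 0)))"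
    by (intro tendsto_intros mu Qd_tendsto d_tendsto w_diff_tendsto)
  ultimately have "\<forall>\<^sub>F k in sequentially. 0 < \<mu> k * c - (M + ?e k)"
    by (intro order_tendstoD(1)) auto
  then show ?thesis
  proof eventually_elim
    case (elim k)
    have "w (Suc k) $ i \<in> {0, 1}" for i
    proof (rule ccontr)
      assume "w (Suc k) $ i \<notin> {0, 1}"
      moreover have "w (Suc k) $ i \<in> {0..1}" using w_cube[of "Suc k"] by (simp add: unit_cube_def)
      ultimately have i: "0 < w (Suc k) $ i" "w (Suc k) $ i < 1" by auto
      define \<nu> where "\<nu> = y k $ i + \<sigma> * (x k $ i - w (Suc k) $ i)"
      have "c \<le> \<bar>\<nu> / \<mu> k\<bar>"
        using spf i subgradient_at_interior_coordinate[OF i, folded \<nu>_def]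
        unfolding sharp_peak_fun_def by (metis atLeastAtMost_iff less_imp_le)
      then have "\<mu> k * c \<le> \<bar>\<nu>\<bar>" using mu_pos[of k] by (simp add: field_simps)
      also have "\<bar>\<nu>\<bar> \<le> \<bar>G (w k) $ i\<bar> + \<bar>(Q k *v (x k - w k)) $ i\<bar> + \<sigma> * \<bar>(x k - w (Suc k)) $ i\<bar>"
      proof -
        have "\<nu> = - (G (w k) $ i) - (Q k *v (x k - w k)) $ i + \<sigma> * (x k - w (Suc k)) $ i"
          unfolding \<nu>_def by (subst y_eq) simp
        moreover have "\<bar>\<sigma> * (x k - w (Suc k)) $ i\<bar> = \<sigma> * \<bar>(x k - w (Suc k)) $ i\<bar>"
          using params by (simp add: abs_mult)
        ultimately show ?thesis by linarith
      qed
      also have "\<dots> \<le> M + norm (Q k *v (x k - w k)) + \<sigma> * norm (x k - w (Suc k))"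
        using params
        by (intro add_mono mult_left_mono component_le_norm_cart
            order_trans[OF component_le_infnorm_cart M[OF w_cube]]) auto
      finally show False using elim by simp
    qed
    then show ?case by (simp add: binary_points_def)
  qed
qed

text \<open>Distinct binary points are at distance at least one while consecutive \<open>w\<close> come arbitrarily close, so
  \<open>w\<close> is eventually constant, and \<open>x\<close> follows it.\<close>
lemma x_converges_to_binary:
  assumes "\<mu> \<longlonglongrightarrow> m" "mu_bar G c < m"
  shows "\<exists>z. x \<longlonglongrightarrow> z \<and> z \<in> binary_points"
proof -
  have "(\<lambda>k. norm (w (Suc k) - w k)) \<longlonglongrightarrow> 0" using w_diff_tendsto by (rule tendsto_norm_zero)
  then have "\<forall>\<^sub>F k in sequentially. norm (w (Suc k) - w k) < 1" by (rule order_tendstoD) simp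
  then have "\<forall>\<^sub>F k in sequentially. norm (w (Suc (Suc k)) - w (Suc k)) < 1"
    by (subst eventually_sequentially_Suc)
  moreover note bin = eventually_w_binary[OF assms]
  moreover have "\<forall>\<^sub>F k in sequentially. w (Suc (Suc k)) \<in> binary_points"
    using bin by (subst eventually_sequentially_Suc)
  ultimately have "\<forall>\<^sub>F k in sequentially. w (Suc k) \<in> binary_points \<and> w (Suc (Suc k)) = w (Suc k)"
    by eventually_elim (auto intro: binary_points_separated)
  then obtain K where K: "\<And>k. K \<le> k \<Longrightarrow> w (Suc k) \<in> binary_points \<and> w (Suc (Suc k)) = w (Suc k)"
    by (auto simp: eventually_sequentially)
  have "w (Suc k) = w (Suc K)" if "K \<le> k" for k
    using that by (induction k rule: dec_induct) (auto simp: K)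
  then have "\<forall>\<^sub>F k in sequentially. w (Suc k) = w (Suc K)"
    unfolding eventually_sequentially by blast
  then have "(\<lambda>k. w (Suc k)) \<longlonglongrightarrow> w (Suc K)" by (rule tendsto_eventually)
  then have "w \<longlonglongrightarrow> w (Suc K)" by (rule LIMSEQ_imp_Suc)
  from tendsto_add[OF d_tendsto this] have "x \<longlonglongrightarrow> w (Suc K)" by simp
  then show ?thesis using K[of K] by blast
qed

lemma aug_Lagrangian_eq: "aug_Lagrangian f g \<sigma> (w k) (x k) (y k) (\<mu> k) = ereal (Lag k)"
  by (simp add: aug_Lagrangian_def Lag_def penalty_eq_phi gap_def)

end

section \<open>The convergence theorem\<close>

theorem theorem4p1:
  fixes f :: "real ^ 'n \<Rightarrow> real" and G :: "real ^ 'n \<Rightarrow> real ^ 'n"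
    and g :: "real \<Rightarrow> ereal"
    and Q :: "nat \<Rightarrow> real ^ 'n ^ 'n"
    and w x y :: "nat \<Rightarrow> real ^ 'n" and \<mu> :: "nat \<Rightarrow> real"
    and c \<mu>\<^sub>0 \<sigma> \<eta> \<rho> \<epsilon> lam \<beta> :: real and k\<^sub>0 :: nat
  assumes grad: "\<And>z. GDERIV f z :> G z"
    and grad_cont: "continuous_on UNIV G"
    and spf: "sharp_peak_fun g c"
    and params: "\<mu>\<^sub>0 > 0" "\<sigma> > 0" "\<eta> > 1" "0 < \<rho>" "\<rho> \<le> 1 / 6" "\<epsilon> > 0" "k\<^sub>0 > 0" "lam > 0"
    and loc_lip: "locally_lipschitz_at_points_of (region_N f \<sigma> (w 0)) G"
    and beta: "\<beta> > 0" "\<beta>-lipschitz_on (region_N f \<sigma> (w 0)) G"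
    and seq: "ShaPeak_sequence g G \<mu>\<^sub>0 \<sigma> \<eta> \<rho> \<epsilon> k\<^sub>0 Q w x y \<mu>"
    and Q_sym: "\<And>k. transpose (Q k) = Q k"
    and Q_psd: "\<And>k v. 0 \<le> v \<bullet> (Q k *v v)"
    and Q_norm: "\<And>k. onorm ((*v) (Q k)) \<le> lam"
    and sigma: "\<sigma> \<ge> 8 * max lam \<beta>"
  shows "\<exists>\<mu>_inf::real.
    \<comment> \<open>1)\<close>
    (\<exists>l::real.
        (\<lambda>k. aug_Lagrangian f g \<sigma> (w k) (x k) (y k) (\<mu> k)) \<longlonglongrightarrow> ereal l \<and>
        (\<lambda>k. aug_Lagrangian f g \<sigma> (w k) (x k) (y k) (\<mu> k)
               + ereal (3 * \<sigma> / 8 * (norm (x k - w k))\<^sup>2)) \<longlonglongrightarrow> ereal l) \<and>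
    \<mu> \<longlonglongrightarrow> \<mu>_inf \<and>
    (\<lambda>k. norm (w (Suc k) - w k)) \<longlonglongrightarrow> 0 \<and>
    (\<lambda>k. norm (x (Suc k) - x k)) \<longlonglongrightarrow> 0 \<and>
    (\<lambda>k. norm (y (Suc k) - y k)) \<longlonglongrightarrow> 0 \<and>
    (\<lambda>k. norm (w k - x k)) \<longlonglongrightarrow> 0 \<and>
    \<comment> \<open>2)\<close>
    (\<forall>x_inf. accumulation_point x x_inf \<longrightarrow> P_stationary_with g G \<mu>_inf (1 / \<sigma>) x_inf) \<and>
    \<comment> \<open>3)\<close>
    (\<mu>_inf > mu_bar G c \<longrightarrow>
       (\<exists>x_inf. x \<longlonglongrightarrow> x_inf \<and> x_inf \<in> binary_points \<and> P_stationary g G \<mu>_inf x_inf))"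
proof -
  interpret shapeak_run f G g Q w x y \<mu> c \<mu>\<^sub>0 \<sigma> \<eta> \<rho> \<epsilon> lam \<beta> k\<^sub>0
    by unfold_locales (fact assms)+
  obtain l where l: "merit \<longlonglongrightarrow> l" "Lag \<longlonglongrightarrow> l" using merit_converges by blast
  obtain m where m: "\<mu> \<longlonglongrightarrow> m" "0 < m" using mu_converges by blast
  have Lag: "(\<lambda>k. aug_Lagrangian f g \<sigma> (w k) (x k) (y k) (\<mu> k)) \<longlonglongrightarrow> ereal l"
    using l(2) by (simp add: aug_Lagrangian_eq)
  have merit: "(\<lambda>k. aug_Lagrangian f g \<sigma> (w k) (x k) (y k) (\<mu> k)
      + ereal (3 * \<sigma> / 8 * (norm (x k - w k))\<^sup>2)) \<longlonglongrightarrow> ereal l"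
    using l(1) by (simp add: aug_Lagrangian_eq merit_def[abs_def] gap_def)
  have wx: "(\<lambda>k. norm (w k - x k)) \<longlonglongrightarrow> 0"
    using gap_tendsto unfolding gap_def by (simp add: norm_minus_commute)
  have stat: "\<forall>z. accumulation_point x z \<longrightarrow> P_stationary_with g G m (1 / \<sigma>) z"
    using accumulation_point_P_stationary[OF m] by blast
  have conv: "\<exists>z. x \<longlonglongrightarrow> z \<and> z \<in> binary_points \<and> P_stationary g G m z" if large: "mu_bar G c < m"
  proof -
    obtain z where z: "x \<longlonglongrightarrow> z" "z \<in> binary_points" using x_converges_to_binary[OF m(1) large] by blast
    have "accumulation_point x z"
      unfolding accumulation_point_def
      by (rule exI[of _ id]) (use z in \<open>simp add: strict_mono_def\<close>)
    then show ?thesis using stat z by (auto simp: P_stationary_def)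
  qed
  show ?thesis
    using Lag merit m tendsto_norm_zero[OF w_diff_tendsto] move_tendsto[unfolded move_def]
      y_diff_tendsto wx stat conv by blast
qed

end
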